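(* Let $\Omega\subset\mathbb{R}^2$ be the interior of a simple polygon, and let $\mathscr{T}$ and $\mathscr{T}'$ be two triangulations of $\overline\Omega$ that are isomorphic via some $\Phi:\overline\Omega\to\overline\Omega$ with $\Phi|_{\partial\Omega}=\mathrm{Id}$. If $\sigma\in PC_+(\mathscr{T})$, then $$\Lambda_\sigma^{\mathrm{FEM}(\mathscr{T})}=\Lambda_{\Phi_*\sigma}^{\mathrm{FEM}(\mathscr{T}')}.$$
   Context: Triangulation: a finite set $\mathscr{T}$ of closed (nondegenerate) triangles in $\mathbb{R}^2$ with union $\overline\Omega$, such that two distinct triangles are either disjoint or meet in exactly one common vertex or one full common edge. $V=\{x_1,\dots,x_N\}$ is the set of all vertices, labeled so that $V_B=\{x_1,\dots,x_B\}=V\cap\partial\Omega$. Two triangulations $\mathscr{T},\mathscr{T}'$ of $\overline\Omega$ are isomorphic via $\Phi$ if $\Phi:\overline\Omega\to\overline\Omega$ is an orientation preserving homeomorphism that is affine on each triangle of $\mathscr{T}$ and gives a one-to-one correspondence between the triangles of $\mathscr{T}$ and those of $\mathscr{T}'$. The vertices of $\mathscr{T}'$ are labeled by $x_j'=\Phi(x_j)$ (so $x_j'=x_j$ for $j\le B$). $PC_+(\mathscr{T})$ is the set of $\sigma\in L^\infty(\Omega;\mathbb{R}^{2\times2})$ that are equal to a constant symmetric positive definite matrix in the interior of each triangle of $\mathscr{T}$. Pushforward: for $y$ in the interior of a triangle of $\mathscr{T}'$, $\Phi_*\sigma(y)=\dfrac{D\Phi(x)\,\sigma(x)\,D\Phi(x)^t}{|\det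 D\Phi(x)|}\Big|_{x=\Phi^{-1}(y)}$. FEM model on $\mathscr{T}$: $v_k:\overline\Omega\to\mathbb{R}$ is the continuous function, affine on each triangle, with $v_k(x_k)=1$ and $v_k(x_j)=0$ for $j\ne k$. $L(\sigma)=(l_{jk})_{j,k=1}^N$ has $l_{jk}=\delta_{jk}$ for $1\le j\le B$ and $l_{jk}=\int_\Omega\sigma\nabla v_j\cdot\nabla v_k\,dx$ for $B+1\le j\le N$. If $L(\sigma)$ is invertible (true for positive definite $\sigma$), $\Lambda_\sigma^{\mathrm{FEM}(\mathscr{T})}:\mathbb{R}^B\to\mathbb{R}^B$ is $(\Lambda_\sigma^{\mathrm{FEM}(\mathscr{T})}f)_j=\sum_{k=1}^N\big(\int_\Omega\sigma\nabla v_j\cdot\nabla v_k\,dx\big)u_k$, $1\le j\le B$, where $L(\sigma)u=(f,0)^t$. *)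

theory Defs
  imports "HOL-Analysis.Analysis"
begin

fun polygonal_path :: "'a::real_normed_vector list \<Rightarrow> real \<Rightarrow> 'a" where
  "polygonal_path [] = linepath 0 0"
| "polygonal_path [a] = linepath a a"
| "polygonal_path [a, b] = linepath a b"
| "polygonal_path (a # b # c # as) = linepath a b +++ polygonal_path (b # c # as)"

definition simple_polygon_interior :: "(real^2) set \<Rightarrow> bool" where
  "simple_polygon_interior \<Omega> \<longleftrightarrow>
     (\<exists>ps. 3 \<le> length ps \<and> simple_path (polygonal_path (ps @ [hd ps])) \<and>
           \<Omega> = inside (path_image (polygonal_path (ps @ [hd ps]))))"

definition is_triangle :: "(real^2) set \<Rightarrow> bool" where
  "is_triangle t \<longleftrightarrow> (\<exists>a b c. \<not> collinear {a, b, c} \<and> t = convex hull {a, b, c})"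

text \<open>For a nondegenerate triangle the extreme points are exactly its three corners.\<close>

definition corners :: "(real^2) set \<Rightarrow> (real^2) set" where
  "corners t = {p. p extreme_point_of t}"

definition plane_triangulation :: "(real^2) set \<Rightarrow> (real^2) set set \<Rightarrow> bool" where
  "plane_triangulation \<Omega> T \<longleftrightarrow>
     finite T \<and> (\<forall>t\<in>T. is_triangle t) \<and> \<Union>T = closure \<Omega> \<and>
     (\<forall>s\<in>T. \<forall>t\<in>T. s \<noteq> t \<longrightarrow>
        s \<inter> t = {} \<or>
        (\<exists>p \<in> corners s \<inter> corners t. s \<inter> t = {p}) \<or>
        (\<exists>p \<in> corners s \<inter> corners t. \<exists>q \<in> corners s \<inter> corners t.
            p \<noteq> q \<and> s \<inter> t = closed_segment p q))"

definition vertices :: "(real^2) set set \<Rightarrow> (real^2) set" where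
  "vertices T = (\<Union>t\<in>T. corners t)"

definition vertex_labelling ::
    "(real^2) set \<Rightarrow> (real^2) set set \<Rightarrow> nat \<Rightarrow> nat \<Rightarrow> (nat \<Rightarrow> real^2) \<Rightarrow> bool" where
  "vertex_labelling \<Omega> T N B x \<longleftrightarrow>
     bij_betw x {1..N} (vertices T) \<and> B \<le> N \<and> x ` {1..B} = vertices T \<inter> frontier \<Omega>"

definition affine_map_on :: "'a::real_vector set \<Rightarrow> ('a \<Rightarrow> 'b::real_vector) \<Rightarrow> bool" where
  "affine_map_on S f \<longleftrightarrow> (\<exists>h c. linear h \<and> (\<forall>y\<in>S. f y = h y + c))"

text \<open>For a homeomorphism that is affine on each triangle, being orientation preserving means
  that its Jacobian determinant is positive inside every triangle.\<close>

definition isomorphic_via ::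
    "(real^2) set \<Rightarrow> (real^2) set set \<Rightarrow> (real^2) set set \<Rightarrow> (real^2 \<Rightarrow> real^2) \<Rightarrow> bool" where
  "isomorphic_via \<Omega> T T' \<Phi> \<longleftrightarrow>
     (\<exists>\<Psi>. homeomorphism (closure \<Omega>) (closure \<Omega>) \<Phi> \<Psi>) \<and>
     (\<forall>t\<in>T. affine_map_on t \<Phi>) \<and>
     (\<forall>t\<in>T. \<forall>y \<in> interior t. 0 < det (jacobian \<Phi> (at y))) \<and>
     bij_betw (\<lambda>t. \<Phi> ` t) T T'"

definition sym_pos_def :: "real^'n^'n \<Rightarrow> bool" where
  "sym_pos_def A \<longleftrightarrow> transpose A = A \<and> (\<forall>v. v \<noteq> 0 \<longrightarrow> 0 < (A *v v) \<bullet> v)"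

definition L_infinity ::
    "'a::euclidean_space set \<Rightarrow> ('a \<Rightarrow> 'b::euclidean_space) set" where
  "L_infinity \<Omega> = {f \<in> borel_measurable (lebesgue_on \<Omega>).
     \<exists>C. AE y in lebesgue_on \<Omega>. norm (f y) \<le> C}"

text \<open>Elements of \<open>L\<^sup>\<infinity>\<close> are represented by arbitrary representatives, so being equal to a
  constant in the interior of a triangle is understood almost everywhere.\<close>

definition PC_plus ::
    "(real^2) set \<Rightarrow> (real^2) set set \<Rightarrow> (real^2 \<Rightarrow> real^2^2) set" where
  "PC_plus \<Omega> T = {\<sigma> \<in> L_infinity \<Omega>.
     \<forall>t\<in>T. \<exists>A. sym_pos_def A \<and> (AE y in lebesgue_on (interior t). \<sigma> y = A)}"

text \<open>Off the interiors of the triangles of the target triangulation, i.e. on a null set of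
  \<open>\<Omega>\<close>, the value of the pushforward carries no meaning.\<close>

definition pushforward ::
    "(real^2) set \<Rightarrow> (real^2 \<Rightarrow> real^2) \<Rightarrow> (real^2 \<Rightarrow> real^2^2) \<Rightarrow> real^2 \<Rightarrow> real^2^2" where
  "pushforward \<Omega> \<Phi> \<sigma> y =
     (let x = inv_into (closure \<Omega>) \<Phi> y; J = jacobian \<Phi> (at x)
      in (1 / \<bar>det J\<bar>) *\<^sub>R (J ** \<sigma> x ** transpose J))"

definition gradient :: "('a::real_inner \<Rightarrow> real) \<Rightarrow> 'a \<Rightarrow> 'a" where
  "gradient f y = (THE D. GDERIV f y :> D)"

text \<open>The nodal function at the vertex \<open>p\<close>. It lives on \<open>\<Union>T\<close>, the closure of the domain;
  it is set to \<open>0\<close> elsewhere only to make it unique as a total function.\<close>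

definition nodal_fun :: "(real^2) set set \<Rightarrow> real^2 \<Rightarrow> real^2 \<Rightarrow> real" where
  "nodal_fun T p = (THE v.
     continuous_on (\<Union>T) v \<and> (\<forall>t\<in>T. affine_map_on t v) \<and>
     (\<forall>q \<in> vertices T. v q = (if q = p then 1 else 0)) \<and>
     (\<forall>y. y \<notin> \<Union>T \<longrightarrow> v y = 0))"

definition stiffness ::
    "(real^2) set \<Rightarrow> (real^2) set set \<Rightarrow> (nat \<Rightarrow> real^2) \<Rightarrow> (real^2 \<Rightarrow> real^2^2)
      \<Rightarrow> nat \<Rightarrow> nat \<Rightarrow> real" where
  "stiffness \<Omega> T x \<sigma> j k =
     (LINT y|lebesgue_on \<Omega>.
        (\<sigma> y *v gradient (nodal_fun T (x j)) y) \<bullet> gradient (nodal_fun T (x k)) y)"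

text \<open>Vectors in \<open>\<real>\<^sup>m\<close> are functions on \<open>nat\<close> of which only the entries with index in
  \<open>{1..m}\<close> matter; vectors produced below vanish outside that range. Matrices are indexed
  likewise.\<close>

definition FEM_matrix ::
    "(real^2) set \<Rightarrow> (real^2) set set \<Rightarrow> nat \<Rightarrow> (nat \<Rightarrow> real^2) \<Rightarrow> (real^2 \<Rightarrow> real^2^2)
      \<Rightarrow> nat \<Rightarrow> nat \<Rightarrow> real" where
  "FEM_matrix \<Omega> T B x \<sigma> j k =
     (if j \<le> B then (if j = k then 1 else 0) else stiffness \<Omega> T x \<sigma> j k)"

definition FEM_solution ::
    "(real^2) set \<Rightarrow> (real^2) set set \<Rightarrow> nat \<Rightarrow> nat \<Rightarrow> (nat \<Rightarrow> real^2) \<Rightarrow> (real^2 \<Rightarrow> real^2^2)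
      \<Rightarrow> (nat \<Rightarrow> real) \<Rightarrow> nat \<Rightarrow> real" where
  "FEM_solution \<Omega> T N B x \<sigma> f = (THE u.
     (\<forall>j\<in>{1..N}. (\<Sum>k=1..N. FEM_matrix \<Omega> T B x \<sigma> j k * u k) = (if j \<le> B then f j else 0)) \<and>
     (\<forall>j. j \<notin> {1..N} \<longrightarrow> u j = 0))"

definition FEM_map ::
    "(real^2) set \<Rightarrow> (real^2) set set \<Rightarrow> nat \<Rightarrow> nat \<Rightarrow> (nat \<Rightarrow> real^2) \<Rightarrow> (real^2 \<Rightarrow> real^2^2)
      \<Rightarrow> (nat \<Rightarrow> real) \<Rightarrow> nat \<Rightarrow> real" where
  "FEM_map \<Omega> T N B x \<sigma> f j =
     (if j \<in> {1..B}
      then \<Sum>k=1..N. stiffness \<Omega> T x \<sigma> j k * FEM_solution \<Omega> T N B x \<sigma> f k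
      else 0)"

end

theory Submission
  imports Defs
begin

text \<open>
  On a triangle \<open>t\<close> the map \<open>\<Phi>\<close> is affine with linear part \<open>M\<close>, so the nodal functions of the target
  triangulation pull back along \<open>\<Phi>\<close> to the nodal functions of the source. Gradients are therefore
  transformed by \<open>M\<^sup>t\<close>, the conductivity becomes \<open>M A M\<^sup>t / \<bar>det M\<bar>\<close>, and the area is multiplied by
  \<open>\<bar>det M\<bar>\<close>: the contribution of each triangle to each stiffness integral is unchanged. Thus both
  triangulations give the same linear system. The integrals over \<open>\<Omega>\<close> split over the triangles because the boundary of
  a polygon is a null set.
\<close>

section \<open>Affine maps on subsets: interpolation, composition and uniqueness\<close>

text \<open>Translating one point \<open>a\<close> of \<open>K\<close> to the origin turns affine
  independence into linear independence of the remaining points. The values relative to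
  \<open>f a\<close> then extend to a linear map, and a constant restores the value at
  \<open>a\<close>.\<close>

lemma affine_interpolation:
  fixes f :: "'a::real_vector \<Rightarrow> 'b::real_vector"
  assumes "\<not> affine_dependent K"
  obtains g where "affine_map_on UNIV g" "\<And>y. y \<in> K \<Longrightarrow> g y = f y"
proof (cases "K = {}")
  case True
  have "affine_map_on UNIV (\<lambda>_::'a. 0::'b)"
    unfolding affine_map_on_def by (intro exI[of _ "\<lambda>_. 0"] exI[of _ 0]) (simp add: module_hom_zero)
  with True that show ?thesis by blast
next
  case False
  then obtain a where a: "a \<in> K" by blast
  then have "independent ((\<lambda>x. -a + x) ` (K - {a}))"
    using assms affine_dependent_iff_dependent2 by blast
  from linear_independent_extend[OF this, of "\<lambda>z. f (a + z) - f a"]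
  obtain h where h: "linear h" "\<And>y. y \<in> K - {a} \<Longrightarrow> h (-a + y) = f y - f a"
    by auto
  define g where "g y = h y + (f a - h a)" for y
  have "g y = f y" if "y \<in> K" for y
  proof (cases "y = a")
    case False
    then have "h (y - a) = f y - f a" using h(2)[of y] that by simp
    then show ?thesis by (simp add: g_def linear_diff[OF h(1)] algebra_simps)
  qed (simp add: g_def)
  moreover have "affine_map_on UNIV g"
    using h(1) by (auto simp: affine_map_on_def g_def)
  ultimately show ?thesis using that by blast
qed

lemma affine_map_on_subset: "affine_map_on S f \<Longrightarrow> R \<subseteq> S \<Longrightarrow> affine_map_on R f"
  unfolding affine_map_on_def by blast

lemma affine_map_on_cong:
  "affine_map_on S f \<Longrightarrow> (\<And>y. y \<in> S \<Longrightarrow> f y = g y) \<Longrightarrow> affine_map_on S g"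
  unfolding affine_map_on_def by metis

lemma affine_map_on_compose:
  assumes "affine_map_on S f" "affine_map_on (f ` S) g"
  shows "affine_map_on S (g \<circ> f)"
proof -
  obtain h c where h: "linear h" "\<And>y. y \<in> S \<Longrightarrow> f y = h y + c"
    using assms(1) unfolding affine_map_on_def by blast
  obtain k d where k: "linear k" "\<And>y. y \<in> f ` S \<Longrightarrow> g y = k y + d"
    using assms(2) unfolding affine_map_on_def by blast
  have "(g \<circ> f) y = (k \<circ> h) y + (k c + d)" if "y \<in> S" for y
    using that h k by (simp add: linear_add)
  then show ?thesis
    using linear_compose[OF h(1) k(1)] unfolding affine_map_on_def by blast
qed

text \<open>The set where the two affine formulas agree is the preimage of a single point under a
  linear map. It is therefore convex, and it contains the hull of \<open>K\<close> as soon as it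
  contains \<open>K\<close>.\<close>

lemma affine_map_on_convex_hull_eq:
  assumes "affine_map_on (convex hull K) f" "affine_map_on (convex hull K) g"
    and "\<And>y. y \<in> K \<Longrightarrow> f y = g y" "y \<in> convex hull K"
  shows "f y = g y"
proof -
  obtain h c where h: "linear h" "\<And>y. y \<in> convex hull K \<Longrightarrow> f y = h y + c"
    using assms(1) unfolding affine_map_on_def by blast
  obtain k d where k: "linear k" "\<And>y. y \<in> convex hull K \<Longrightarrow> g y = k y + d"
    using assms(2) unfolding affine_map_on_def by blast
  have "{y. h y + c = k y + d} = (\<lambda>y. h y - k y) -` {d - c}"
    by (auto simp: algebra_simps)
  then have "convex {y. h y + c = k y + d}"
    using convex_linear_vimage[OF linear_compose_sub[OF h(1) k(1)] convex_singleton[of "d - c"]]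
    by simp
  moreover have "K \<subseteq> {y. h y + c = k y + d}"
    using assms(3) h(2) k(2) by (metis (mono_tags) hull_inc mem_Collect_eq subsetI)
  ultimately have "convex hull K \<subseteq> {y. h y + c = k y + d}"
    by (rule hull_minimal[rotated])
  then show ?thesis using assms(4) h(2) k(2) by auto
qed

text \<open>The vector \<open>g\<close> is the adjoint of the linear part applied to 1; in the
  interior of \<open>S\<close> it is the gradient.\<close>

lemma affine_map_on_realE:
  fixes f :: "'a::euclidean_space \<Rightarrow> real"
  assumes "affine_map_on S f"
  obtains g b where "\<And>y. y \<in> S \<Longrightarrow> f y = y \<bullet> g + b"
proof -
  obtain h c where h: "linear h" "\<And>y. y \<in> S \<Longrightarrow> f y = h y + c"
    using assms unfolding affine_map_on_def by blast
  have "h y = y \<bullet> adjoint h 1" for y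
    using adjoint_works[OF h(1), of y 1] by simp
  with h(2) that show ?thesis by simp
qed

section \<open>Triangles, their corners and their intersections\<close>

text \<open>Extreme points of the hull of an affinely independent set are exactly its generators.
  This describes a triangle by its intrinsic corner set, with no choice of \<open>a\<close>,
  \<open>b\<close>, \<open>c\<close>.\<close>

lemma is_triangle_convex_hull_corners:
  assumes "is_triangle t"
  shows "t = convex hull corners t" "\<not> affine_dependent (corners t)"
proof -
  obtain a b c where abc: "\<not> collinear {a,b,c}" "t = convex hull {a,b,c}"
    using assms unfolding is_triangle_def by blast
  then have ind: "\<not> affine_dependent {a,b,c}"
    by (auto simp: collinear_3_eq_affine_dependent)
  then have "corners t = {a,b,c}"
    using abc(2) by (auto simp: corners_def extreme_point_of_convex_hull_affine_independent)
  with abc ind show "t = convex hull corners t" "\<not> affine_dependent (corners t)"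
    by simp_all
qed

lemma is_triangle_topology:
  assumes "is_triangle t"
  shows "compact t" "convex t" "interior t \<noteq> {}" "t \<in> lmeasurable"
proof -
  obtain a b c where abc: "\<not> collinear {a,b,c}" "t = convex hull {a,b,c}"
    using assms unfolding is_triangle_def by blast
  show "compact t" "convex t"
    using abc(2) by (auto intro: finite_imp_compact_convex_hull)
  then show "t \<in> lmeasurable" by (simp add: lmeasurable_compact)
  \<comment> \<open>The barycentre has positive barycentric coordinates, which characterizes
    interior points.\<close>
  have "(1/3) *\<^sub>R a + (1/3) *\<^sub>R b + (1/3) *\<^sub>R c \<in> interior t"
    unfolding abc(2) interior_convex_hull_3_minimal[OF abc(1), simplified]
    by (rule CollectI, intro exI[of _ "1/3"] conjI) simp_all
  then show "interior t \<noteq> {}" by blast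
qed

lemma corners_subset: "corners t \<subseteq> t"
  by (auto simp: corners_def extreme_point_of_def)

text \<open>An injective affine map preserves and reflects membership in open segments, and extreme
  points are defined by open segments alone.\<close>

lemma corners_affine_image:
  assumes "affine_map_on t \<Phi>" "inj_on \<Phi> t" "convex t"
  shows "corners (\<Phi> ` t) = \<Phi> ` corners t"
proof -
  obtain h d where h: "linear h" "\<And>y. y \<in> t \<Longrightarrow> \<Phi> y = h y + d"
    using assms(1) unfolding affine_map_on_def by blast
  have comb: "(1 - u) *\<^sub>R a + u *\<^sub>R b \<in> t"
      "\<Phi> ((1 - u) *\<^sub>R a + u *\<^sub>R b) = (1 - u) *\<^sub>R \<Phi> a + u *\<^sub>R \<Phi> b"
    if "a \<in> t" "b \<in> t" "0 < u" "u < 1" for a b and u :: real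
  proof -
    show *: "(1 - u) *\<^sub>R a + u *\<^sub>R b \<in> t"
      using assms(3) that by (intro convexD_alt) auto
    show "\<Phi> ((1 - u) *\<^sub>R a + u *\<^sub>R b) = (1 - u) *\<^sub>R \<Phi> a + u *\<^sub>R \<Phi> b"
      using that by (simp add: h(2)[OF *] h(2) linear_add[OF h(1)] linear_scale[OF h(1)])
        (simp add: algebra_simps)
  qed
  have seg: "\<Phi> p \<in> open_segment (\<Phi> a) (\<Phi> b) \<longleftrightarrow> p \<in> open_segment a b"
    if "a \<in> t" "b \<in> t" "p \<in> t" for a b p
  proof -
    have "\<Phi> p = (1 - u) *\<^sub>R \<Phi> a + u *\<^sub>R \<Phi> b \<longleftrightarrow> p = (1 - u) *\<^sub>R a + u *\<^sub>R b"
      if "0 < u" "u < 1" for u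
      using comb[of a b u] that \<open>a \<in> t\<close> \<open>b \<in> t\<close> \<open>p \<in> t\<close> assms(2)
      by (metis inj_onD)
    \<comment> \<open>An open segment with coinciding ends is empty, so distinctness of the ends has
      to be transported too.\<close>
    moreover have "\<Phi> a = \<Phi> b \<longleftrightarrow> a = b"
      using that assms(2) by (metis inj_onD)
    ultimately show ?thesis unfolding in_segment by metis
  qed
  have "p extreme_point_of t \<longleftrightarrow> \<Phi> p extreme_point_of (\<Phi> ` t)" if "p \<in> t" for p
    unfolding extreme_point_of_def using seg that by auto
  then show ?thesis
    unfolding corners_def by (auto simp: extreme_point_of_def)
qed

text \<open>Equal, disjoint, vertex-sharing and edge-sharing triangles are brought into one form,
  with \<open>K\<close> empty in the disjoint case, so that agreement of affine maps on an overlap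
  can be tested at common corners.\<close>

lemma plane_triangulation_Int:
  assumes "plane_triangulation \<Omega> T" "s \<in> T" "t \<in> T"
  obtains K where "s \<inter> t = convex hull K" "K \<subseteq> corners s \<inter> corners t"
proof (cases "s = t")
  case True
  then show ?thesis
    using that[of "corners t"] is_triangle_convex_hull_corners[of t] assms
    by (simp add: plane_triangulation_def)
next
  case False
  then consider "s \<inter> t = {}" | p where "p \<in> corners s \<inter> corners t" "s \<inter> t = {p}"
    | p q where "p \<in> corners s \<inter> corners t" "q \<in> corners s \<inter> corners t" "s \<inter> t = closed_segment p q"
    using assms(1)[unfolded plane_triangulation_def, THEN conjunct2, THEN conjunct2, THEN conjunct2,
        rule_format, OF assms(2,3) False] by blast
  then show ?thesis
  proof cases
    case 1
    then show ?thesis using that[of "{}"] by simp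
  next
    case (2 p)
    then show ?thesis using that[of "{p}"] by simp
  next
    case (3 p q)
    then show ?thesis using that[of "{p,q}"] by (simp add: segment_convex_hull)
  qed
qed

text \<open>In dimension at least two a segment is a convex set with empty interior, hence
  null.\<close>

lemma negligible_closed_segment:
  fixes a b :: "'a::euclidean_space"
  assumes "2 \<le> DIM('a)"
  shows "negligible (closed_segment a b)"
  using assms by (simp add: negligible_convex_interior interior_closed_segment_ge2)

lemma plane_triangulation_negligible_Int:
  assumes "plane_triangulation \<Omega> T" "s \<in> T" "t \<in> T" "s \<noteq> t"
  shows "negligible (s \<inter> t)"
proof -
  have "negligible (closed_segment p q)" for p q :: "real^2"
    by (simp add: negligible_closed_segment)
  then show ?thesis
    using assms unfolding plane_triangulation_def
    by (metis negligible_empty negligible_sing)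
qed

section \<open>Existence and uniqueness of the nodal functions\<close>

lemma vertices_subset: "vertices T \<subseteq> \<Union>T"
  by (auto simp: vertices_def corners_def extreme_point_of_def)

text \<open>The description in \<open>nodal_fun\<close> is usable only after existence and
  uniqueness. Existence comes from gluing the affine interpolants of the individual triangles;
  uniqueness holds because corner values determine an affine function on a triangle and the value
  off the triangles is fixed.\<close>

lemma nodal_fun_properties:
  assumes T: "plane_triangulation \<Omega> T"
  shows "t \<in> T \<Longrightarrow> affine_map_on t (nodal_fun T p)"
    and "q \<in> vertices T \<Longrightarrow> nodal_fun T p q = (if q = p then 1 else 0)"
proof -
  define Q where "Q v \<longleftrightarrow> continuous_on (\<Union>T) v \<and> (\<forall>t\<in>T. affine_map_on t v) \<and>
     (\<forall>q \<in> vertices T. v q = (if q = p then 1 else 0)) \<and>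
     (\<forall>y. y \<notin> \<Union>T \<longrightarrow> v y = 0)" for v :: "real^2 \<Rightarrow> real"
  have tri: "is_triangle t" if "t \<in> T" for t
    using that T by (simp add: plane_triangulation_def)
  have "\<exists>g :: real^2 \<Rightarrow> real. affine_map_on UNIV g \<and> (\<forall>q \<in> corners t. g q = (if q = p then 1 else 0))"
    if "t \<in> T" for t
    using affine_interpolation[OF is_triangle_convex_hull_corners(2)[OF tri[OF that]],
        of "\<lambda>q. if q = p then 1 else 0"] by metis
  then obtain g :: "(real^2) set \<Rightarrow> real^2 \<Rightarrow> real" where
    g: "\<And>t. t \<in> T \<Longrightarrow> affine_map_on UNIV (g t)"
       "\<And>t q. t \<in> T \<Longrightarrow> q \<in> corners t \<Longrightarrow> g t q = (if q = p then 1 else 0)"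
    by metis
  \<comment> \<open>On the overlap both interpolants are determined by the values at common corners,
    and the prescribed value at a corner does not depend on the triangle.\<close>
  have agree: "g s y = g t y" if st: "s \<in> T" "t \<in> T" "y \<in> s" "y \<in> t" for s t y
  proof -
    obtain K where K: "s \<inter> t = convex hull K" "K \<subseteq> corners s \<inter> corners t"
      using plane_triangulation_Int[OF T st(1,2)] .
    show ?thesis
    proof (rule affine_map_on_convex_hull_eq[of K])
      show "affine_map_on (convex hull K) (g s)" "affine_map_on (convex hull K) (g t)"
        using g(1) st affine_map_on_subset subset_UNIV by blast+
      show "g s z = g t z" if "z \<in> K" for z
        using that K(2) g(2) st by (auto simp: subset_eq)
      show "y \<in> convex hull K" using st K(1) by auto
    qed
  qed
  \<comment> \<open>By \<open>agree\<close> the chosen triangle does not affect the value.\<close>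
  define v where "v y = (if y \<in> \<Union>T then g (SOME t. t \<in> T \<and> y \<in> t) y else 0)" for y
  have v: "v y = g t y" if "t \<in> T" "y \<in> t" for t y
  proof -
    let ?s = "SOME t. t \<in> T \<and> y \<in> t"
    have s: "?s \<in> T \<and> y \<in> ?s"
      using that by (intro someI[of "\<lambda>t. t \<in> T \<and> y \<in> t" t]) auto
    have "v y = g ?s y"
      unfolding v_def by (rule if_P) (use that in blast)
    then show ?thesis using agree[of ?s t y] s that by metis
  qed
  have aff: "affine_map_on t v" if "t \<in> T" for t
    using affine_map_on_cong[OF affine_map_on_subset[OF g(1)[OF that] subset_UNIV], of t v] v that
    by simp
  have "continuous_on t v" if t: "t \<in> T" for t
  proof -
    obtain h c where h: "linear h" "\<And>y. y \<in> t \<Longrightarrow> v y = h y + c"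
      using aff[OF t] unfolding affine_map_on_def by blast
    have "continuous_on t (\<lambda>y. h y + c)"
      by (intro continuous_on_add linear_continuous_on continuous_on_const
          linear_conv_bounded_linear[THEN iffD1] h(1))
    then show ?thesis using h(2) by (simp cong: continuous_on_cong)
  qed
  \<comment> \<open>Continuity on finitely many closed pieces gives continuity on their
    union.\<close>
  then have "continuous_on (\<Union>t\<in>T. t) v"
    using T tri is_triangle_topology(1) compact_imp_closed
    by (intro continuous_on_closed_Union) (auto simp: plane_triangulation_def)
  moreover have "v q = (if q = p then 1 else 0)" if q: "q \<in> vertices T" for q
  proof -
    obtain t where t: "t \<in> T" "q \<in> corners t" using q unfolding vertices_def by blast
    then have "q \<in> t" using corners_subset by blast
    then show ?thesis using v[OF t(1)] g(2)[OF t] by simp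
  qed
  ultimately have "Q v"
    unfolding Q_def using aff by (simp add: v_def)
  moreover have "w = v" if "Q w" for w
  proof
    fix y
    show "w y = v y"
    proof (cases "y \<in> \<Union>T")
      case True
      then obtain t where t: "t \<in> T" "y \<in> t" by blast
      have eq: "convex hull corners t = t"
        using is_triangle_convex_hull_corners(1)[OF tri[OF t(1)]] by simp
      have ver: "corners t \<subseteq> vertices T" using t by (auto simp: vertices_def)
      show ?thesis
        using \<open>Q w\<close> \<open>Q v\<close> t ver
        by (intro affine_map_on_convex_hull_eq[of "corners t" w v y])
          (auto simp: eq Q_def subset_eq)
    next
      case False
      then show ?thesis using \<open>Q w\<close> \<open>Q v\<close> by (simp add: Q_def)
    qed
  qed
  ultimately have "Q (THE v. Q v)" by (rule theI)
  moreover have "nodal_fun T p = (THE v. Q v)"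
    unfolding nodal_fun_def Q_def ..
  ultimately have "Q (nodal_fun T p)" by simp
  then show "t \<in> T \<Longrightarrow> affine_map_on t (nodal_fun T p)"
    and "q \<in> vertices T \<Longrightarrow> nodal_fun T p q = (if q = p then 1 else 0)"
    by (auto simp: Q_def)
qed

section \<open>Gradients and Jacobians of affine pieces\<close>

text \<open>Derivatives are unique, and a vector is determined by its inner products. This is what
  evaluates the \<open>THE\<close> in \<open>gradient\<close>.\<close>

lemma GDERIV_unique:
  assumes "GDERIV f x :> D" "GDERIV f x :> E"
  shows "D = E"
proof -
  have "(\<lambda>h. h \<bullet> D) = (\<lambda>h. h \<bullet> E)"
    using assms has_derivative_unique unfolding gderiv_def by blast
  then show ?thesis by (metis vector_eq_ldot)
qed

lemma GDERIV_affine_on: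
  assumes "\<And>y. y \<in> S \<Longrightarrow> f y = y \<bullet> g + b" "y \<in> interior S"
  shows "GDERIV f y :> g"
  unfolding gderiv_def
proof (rule has_derivative_transform_within_open[OF _ open_interior assms(2)])
  show "((\<lambda>y. y \<bullet> g + b) has_derivative (\<lambda>h. h \<bullet> g)) (at y)"
    by (auto intro!: derivative_eq_intros)
qed (use assms(1) interior_subset[of S] in \<open>auto simp: subset_eq\<close>)

lemma gradient_affine_on:
  assumes "\<And>y. y \<in> S \<Longrightarrow> f y = y \<bullet> g + b" "y \<in> interior S"
  shows "gradient f y = g"
  unfolding gradient_def
  by (rule the_equality) (use GDERIV_affine_on[OF assms] GDERIV_unique in metis)+

lemma jacobian_affine_on:
  fixes f h :: "real^'n \<Rightarrow> real^'m"
  assumes "linear h" "\<And>y. y \<in> S \<Longrightarrow> f y = h y + d" "y \<in> interior S"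
  shows "jacobian f (at y) = matrix h"
proof -
  have "(f has_derivative h) (at y)"
  proof (rule has_derivative_transform_within_open[OF _ open_interior assms(3)])
    show "((\<lambda>y. h y + d) has_derivative h) (at y)"
      using has_derivative_add[OF linear_imp_has_derivative[OF assms(1)] has_derivative_const]
      by simp
  qed (use assms(2) interior_subset[of S] in \<open>auto simp: subset_eq\<close>)
  then show ?thesis unfolding jacobian_def using frechet_derivative_at by metis
qed

section \<open>Stiffness integrals as finite sums over triangles\<close>

text \<open>Off a null set, \<open>f\<close> cut off to \<open>\<Omega>\<close> equals the step
  function \<open>g\<close> built from the indicators of the pieces, and it inherits integrability
  and integral from \<open>g\<close>.\<close>

lemma integral_piecewise_constant:
  fixes f :: "'a::euclidean_space \<Rightarrow> real"
  assumes "finite T" "\<And>t. t \<in> T \<Longrightarrow> t \<in> lmeasurable"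
    and "\<And>s t. s \<in> T \<Longrightarrow> t \<in> T \<Longrightarrow> s \<noteq> t \<Longrightarrow> negligible (s \<inter> t)"
    and \<Omega>: "\<Omega> \<in> sets lebesgue" "negligible (\<Omega> - \<Union>T)" "negligible (\<Union>T - \<Omega>)"
    and f: "\<And>t. t \<in> T \<Longrightarrow> \<exists>N. negligible N \<and> (\<forall>y \<in> t - N. f y = c t)"
  shows "(LINT y|lebesgue_on \<Omega>. f y) = (\<Sum>t\<in>T. c t * measure lebesgue t)"
proof -
  obtain N where N: "\<And>t. t \<in> T \<Longrightarrow> negligible (N t)" "\<And>t y. t \<in> T \<Longrightarrow> y \<in> t - N t \<Longrightarrow> f y = c t"
    using f by metis
  \<comment> \<open>\<open>W s\<close> is the part of \<open>s\<close> shared with other pieces;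
    outside it only one indicator in \<open>g\<close> is nonzero.\<close>
  define W where "W s = \<Union>((\<inter>) s ` (T - {s}))" for s
  have W: "negligible (W s)" if "s \<in> T" for s
    unfolding W_def
  proof (rule negligible_Union)
    show "finite ((\<inter>) s ` (T - {s}))" using assms(1) by blast
    show "negligible r" if "r \<in> (\<inter>) s ` (T - {s})" for r
      using that assms(3) \<open>s \<in> T\<close> by blast
  qed
  define Z where "Z = (\<Omega> - \<Union>T) \<union> (\<Union>T - \<Omega>) \<union> (\<Union>t\<in>T. N t) \<union> (\<Union>s\<in>T. W s)"
  have Z: "negligible Z"
    unfolding Z_def using assms(1,5,6) N(1) W
    by (intro negligible_Un negligible_Union) auto
  define g where "g y = (\<Sum>t\<in>T. c t * indicat_real t y)" for y
  have int: "integrable lebesgue (\<lambda>y. c t * indicat_real t y)" if "t \<in> T" for t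
    using assms(2)[OF that] by (intro integrable_mult_right integrable_real_indicator)
      (auto simp: fmeasurable_def)
  have gint: "integrable lebesgue g"
    unfolding g_def using int by (intro Bochner_Integration.integrable_sum)
  have "integral\<^sup>L lebesgue g = (\<Sum>t\<in>T. integral\<^sup>L lebesgue (\<lambda>y. c t * indicat_real t y))"
    unfolding g_def using int by (intro Bochner_Integration.integral_sum)
  also have "\<dots> = (\<Sum>t\<in>T. c t * measure lebesgue t)" by simp
  finally have gI: "integral\<^sup>L lebesgue g = (\<Sum>t\<in>T. c t * measure lebesgue t)" .
  have fg: "indicat_real \<Omega> y * f y = g y" if "y \<notin> Z" for y
  proof (cases "y \<in> \<Union>T")
    case True
    then obtain t where t: "t \<in> T" "y \<in> t" by blast
    have "y \<notin> s" if "s \<in> T" "s \<noteq> t" for s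
      using that t \<open>y \<notin> Z\<close> unfolding Z_def W_def by blast
    then have "g y = (\<Sum>s\<in>T. if s = t then c t else 0)"
      unfolding g_def using t by (intro sum.cong) (auto simp: indicator_def)
    also have "\<dots> = c t" using t assms(1) by simp
    also have "c t = f y" using N(2)[OF t(1)] t that by (auto simp: Z_def)
    finally show ?thesis using t that by (auto simp: Z_def)
  next
    case False
    then show ?thesis using that by (auto simp: Z_def g_def sum.neutral)
  qed
  \<comment> \<open>The gauge integral ignores negligible sets without asking for measurability of
    \<open>f\<close>; absolute integrability on both sides carries the equality back to the Lebesgue
    integral.\<close>
  have gabs: "g absolutely_integrable_on UNIV"
    using gint by (simp add: set_integrable_def)
  have fabs: "(\<lambda>y. indicat_real \<Omega> y * f y) absolutely_integrable_on UNIV"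
    by (rule absolutely_integrable_spike[OF gabs Z]) (use fg in auto)
  then have "integral\<^sup>L lebesgue (\<lambda>y. indicat_real \<Omega> y * f y) = integral UNIV (\<lambda>y. indicat_real \<Omega> y * f y)"
    using set_lebesgue_integral_eq_integral(2)[OF fabs] by (simp add: set_lebesgue_integral_def)
  also have "\<dots> = integral UNIV g"
    by (rule integral_spike[OF Z]) (use fg in auto)
  also have "\<dots> = integral\<^sup>L lebesgue g"
    using set_lebesgue_integral_eq_integral(2)[OF gabs] by (simp add: set_lebesgue_integral_def)
  finally show ?thesis using gI \<Omega>(1) by (simp add: integral_restrict_space)
qed

text \<open>The integrand is constant on each triangle away from its frontier and the exceptional
  set of \<open>\<sigma>\<close>. Gradients are evaluated only in the interior, which suffices since
  the frontier of a convex set is null.\<close>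

lemma stiffness_eq_sum:
  assumes T: "plane_triangulation \<Omega> T" and "open \<Omega>" "negligible (frontier \<Omega>)"
    and A: "\<And>t. t \<in> T \<Longrightarrow> \<exists>N. negligible N \<and> (\<forall>y \<in> t - N. \<sigma> y = A t)"
    and gj: "\<And>t y. t \<in> T \<Longrightarrow> y \<in> t \<Longrightarrow> nodal_fun T (x j) y = y \<bullet> g t + a t"
    and gk: "\<And>t y. t \<in> T \<Longrightarrow> y \<in> t \<Longrightarrow> nodal_fun T (x k) y = y \<bullet> e t + b t"
  shows "stiffness \<Omega> T x \<sigma> j k = (\<Sum>t\<in>T. (A t *v g t) \<bullet> e t * measure lebesgue t)"
  unfolding stiffness_def
proof (rule integral_piecewise_constant)
  have tri: "is_triangle t" if "t \<in> T" for t
    using that T by (simp add: plane_triangulation_def)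
  show "finite T" using T by (simp add: plane_triangulation_def)
  show "t \<in> lmeasurable" if "t \<in> T" for t using tri[OF that] is_triangle_topology by blast
  show "negligible (s \<inter> t)" if "s \<in> T" "t \<in> T" "s \<noteq> t" for s t
    using plane_triangulation_negligible_Int T that by blast
  show "\<Omega> \<in> sets lebesgue" using \<open>open \<Omega>\<close> by auto
  have cl: "\<Union>T = closure \<Omega>" using T by (simp add: plane_triangulation_def)
  show "negligible (\<Omega> - \<Union>T)"
    unfolding cl using closure_subset[of \<Omega>] by (metis Diff_eq_empty_iff negligible_empty)
  \<comment> \<open>For open \<open>\<Omega>\<close> this difference is exactly the
    frontier.\<close>
  show "negligible (\<Union>T - \<Omega>)"
    unfolding cl using assms(2,3) by (simp add: frontier_def interior_open)
  show "\<exists>N. negligible N \<and> (\<forall>y\<in>t - N. (\<sigma> y *v gradient (nodal_fun T (x j)) y) \<bullet>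
      gradient (nodal_fun T (x k)) y = (A t *v g t) \<bullet> e t)" if t: "t \<in> T" for t
  proof -
    obtain N where N: "negligible N" "\<And>y. y \<in> t - N \<Longrightarrow> \<sigma> y = A t" using A[OF t] by blast
    have "negligible (N \<union> frontier t)"
      using N(1) is_triangle_topology(2)[OF tri[OF t]] by (simp add: negligible_convex_frontier)
    moreover have "(\<sigma> y *v gradient (nodal_fun T (x j)) y) \<bullet>
      gradient (nodal_fun T (x k)) y = (A t *v g t) \<bullet> e t" if y: "y \<in> t - (N \<union> frontier t)" for y
    proof -
      have i: "y \<in> interior t" using y closure_subset by (auto simp: frontier_def)
      show ?thesis
        using gradient_affine_on[OF gj[OF t] i] gradient_affine_on[OF gk[OF t] i] N(2) y by simp
    qed
    ultimately show ?thesis by blast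
  qed
qed

section \<open>Null boundary of a polygon and exceptional sets of the conductivity\<close>

text \<open>The path consists of finitely many segments. An inclusion for the image of a join is
  enough, so matching endpoints need not be tracked.\<close>

lemma negligible_polygonal_path:
  fixes ps :: "'a::euclidean_space list"
  assumes "2 \<le> DIM('a)"
  shows "negligible (path_image (polygonal_path ps))"
proof (induction ps rule: polygonal_path.induct)
  case (4 a b c as)
  have "negligible (path_image (linepath a b) \<union> path_image (polygonal_path (b # c # as)))"
    using 4 negligible_closed_segment[OF assms, of a b] by (intro negligible_Un) simp_all
  from negligible_subset[OF this path_image_join_subset] show ?case by simp
qed (simp_all add: negligible_closed_segment[OF assms])

lemma simple_polygon_interior_topology:
  assumes "simple_polygon_interior \<Omega>"
  shows "open \<Omega>" "negligible (frontier \<Omega>)"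
proof -
  \<comment> \<open>Here \<open>ps\<close> comes from the closed list of polygon vertices, with the
    first one repeated at the end.\<close>
  obtain ps :: "(real^2) list" where ps: "simple_path (polygonal_path ps)"
      "\<Omega> = inside (path_image (polygonal_path ps))"
    using assms unfolding simple_polygon_interior_def by blast
  have "closed (path_image (polygonal_path ps))"
    using ps(1) by (intro closed_path_image simple_path_imp_path)
  then show "open \<Omega>" "negligible (frontier \<Omega>)"
    unfolding ps(2)
    by (auto intro: open_inside negligible_subset[OF negligible_polygonal_path frontier_inside_subset])
qed

text \<open>An explicit null set replaces the almost-everywhere statement, because it can be mapped
  forward by \<open>\<Phi>\<close>. It absorbs the frontier of \<open>t\<close> as well.\<close>

lemma PC_plus_constant:
  assumes "\<sigma> \<in> PC_plus \<Omega> T" "t \<in> T" "convex t"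
  obtains A N where "negligible N" "\<And>y. y \<in> t - N \<Longrightarrow> \<sigma> y = A"
proof -
  obtain A where "AE y in lebesgue_on (interior t). \<sigma> y = A"
    using assms unfolding PC_plus_def by blast
  then have "AE y in lebesgue. y \<in> interior t \<longrightarrow> \<sigma> y = A"
    by (subst (asm) AE_restrict_space_iff) auto
  then obtain N where N: "negligible N" "{y. \<not> (y \<in> interior t \<longrightarrow> \<sigma> y = A)} \<subseteq> N"
    unfolding eventually_ae_filter negligible_iff_null_sets by auto
  have "negligible (N \<union> frontier t)"
    using N(1) negligible_convex_frontier[OF assms(3)] by simp
  moreover have "\<sigma> y = A" if "y \<in> t - (N \<union> frontier t)" for y
    using that N(2) closure_subset by (auto simp: frontier_def)
  ultimately show ?thesis using that by blast
qed

section \<open>Transport of vertices, nodal functions and stiffness along the isomorphism\<close>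

lemma vertices_isomorphic:
  assumes T: "plane_triangulation \<Omega> T" and iso: "isomorphic_via \<Omega> T T' \<Phi>"
  shows "vertices T' = \<Phi> ` vertices T"
proof -
  have inj: "inj_on \<Phi> (closure \<Omega>)"
    using iso unfolding isomorphic_via_def homeomorphism_def by (metis inj_on_inverseI)
  have "corners (\<Phi> ` t) = \<Phi> ` corners t" if "t \<in> T" for t
  proof (rule corners_affine_image)
    show "affine_map_on t \<Phi>" using iso that unfolding isomorphic_via_def by blast
    have "t \<subseteq> closure \<Omega>" "is_triangle t"
      using T that by (auto simp: plane_triangulation_def)
    then show "inj_on \<Phi> t" "convex t"
      using inj inj_on_subset is_triangle_topology(2) by blast+
  qed
  moreover have "T' = (\<lambda>t. \<Phi> ` t) ` T"
    using iso unfolding isomorphic_via_def bij_betw_def by blast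
  ultimately show ?thesis unfolding vertices_def by auto
qed

text \<open>On each triangle of \<open>T\<close> the pullback of the target nodal function is
  affine, since \<open>\<Phi>\<close> maps that triangle affinely onto one of \<open>T'\<close>.
  Injectivity of \<open>\<Phi>\<close> gives it the same values at the corners, and these determine
  it.\<close>

lemma nodal_fun_isomorphic:
  assumes T: "plane_triangulation \<Omega> T" and T': "plane_triangulation \<Omega> T'"
    and iso: "isomorphic_via \<Omega> T T' \<Phi>"
    and p: "p \<in> vertices T" and y: "y \<in> closure \<Omega>"
  shows "nodal_fun T p y = nodal_fun T' (\<Phi> p) (\<Phi> y)"
proof -
  have inj: "inj_on \<Phi> (closure \<Omega>)"
    using iso unfolding isomorphic_via_def homeomorphism_def by (metis inj_on_inverseI)
  have cl: "\<Union>T = closure \<Omega>" using T by (simp add: plane_triangulation_def)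
  then obtain t where t: "t \<in> T" "y \<in> t" using y by blast
  have t': "\<Phi> ` t \<in> T'" using iso t unfolding isomorphic_via_def bij_betw_def by blast
  have tri: "convex hull corners t = t"
    using is_triangle_convex_hull_corners(1)[of t] T t by (simp add: plane_triangulation_def)
  have "nodal_fun T p y = (nodal_fun T' (\<Phi> p) \<circ> \<Phi>) y"
  proof (rule affine_map_on_convex_hull_eq[of "corners t"]; (unfold tri)?)
    show "affine_map_on t (nodal_fun T p)" using nodal_fun_properties(1)[OF T t(1)] .
    show "affine_map_on t (nodal_fun T' (\<Phi> p) \<circ> \<Phi>)"
      using iso t(1) nodal_fun_properties(1)[OF T' t']
      by (intro affine_map_on_compose) (auto simp: isomorphic_via_def)
    show "y \<in> t" by fact
    show "nodal_fun T p q = (nodal_fun T' (\<Phi> p) \<circ> \<Phi>) q" if q: "q \<in> corners t" for q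
    proof -
      have qv: "q \<in> vertices T" using q t(1) by (auto simp: vertices_def)
      then have "\<Phi> q \<in> vertices T'" using vertices_isomorphic[OF T iso] by blast
      moreover have "\<Phi> q = \<Phi> p \<longleftrightarrow> q = p"
        using inj qv p vertices_subset[of T] cl by (metis inj_on_eq_iff subsetD)
      ultimately show ?thesis
        using nodal_fun_properties(2)[OF T qv, of p] nodal_fun_properties(2)[OF T', of "\<Phi> q" "\<Phi> p"]
        by simp
    qed
  qed
  then show ?thesis by simp
qed

lemma inner_matrix_vector_transpose:
  fixes M :: "real^'n^'m"
  shows "(M *v v) \<bullet> w = v \<bullet> (transpose M *v w)"
  using dot_lmul_matrix[of w M v] by (simp only: transpose_matrix_vector inner_commute)

text \<open>Both integrals become finite sums, matched by sending each triangle to its image under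
  \<open>\<Phi>\<close>. The change of variables thus reduces to the area of an affine image of a
  triangle.\<close>

lemma stiffness_pushforward:
  assumes \<Omega>: "open \<Omega>" "negligible (frontier \<Omega>)"
    and T: "plane_triangulation \<Omega> T" and T': "plane_triangulation \<Omega> T'"
    and iso: "isomorphic_via \<Omega> T T' \<Phi>"
    and \<sigma>: "\<sigma> \<in> PC_plus \<Omega> T"
    and jk: "x j \<in> vertices T" "x k \<in> vertices T"
  shows "stiffness \<Omega> T' (\<Phi> \<circ> x) (pushforward \<Omega> \<Phi> \<sigma>) j k = stiffness \<Omega> T x \<sigma> j k"
proof -
  have cl: "\<Union>T = closure \<Omega>" using T by (simp add: plane_triangulation_def)
  have inj: "inj_on \<Phi> (closure \<Omega>)"
    using iso unfolding isomorphic_via_def homeomorphism_def by (metis inj_on_inverseI)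
  have bij: "bij_betw (\<lambda>t. \<Phi> ` t) T T'" using iso unfolding isomorphic_via_def by blast
  have tri: "is_triangle t" if "t \<in> T" for t
    using that T by (simp add: plane_triangulation_def)
  have "\<exists>A N. negligible N \<and> (\<forall>y \<in> t - N. \<sigma> y = A)" if "t \<in> T" for t
    using PC_plus_constant[OF \<sigma> that is_triangle_topology(2)[OF tri[OF that]]] by metis
  then obtain A N where A: "\<And>t. t \<in> T \<Longrightarrow> negligible (N t)"
    "\<And>t y. t \<in> T \<Longrightarrow> y \<in> t - N t \<Longrightarrow> \<sigma> y = A t" by metis
  have "\<exists>h d. linear h \<and> (\<forall>y\<in>t. \<Phi> y = h y + d)" if "t \<in> T" for t
    using iso that unfolding isomorphic_via_def affine_map_on_def by blast
  then obtain h d where h: "\<And>t. t \<in> T \<Longrightarrow> linear (h t)"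
    "\<And>t y. t \<in> T \<Longrightarrow> y \<in> t \<Longrightarrow> \<Phi> y = h t y + d t" by metis
  define M where "M t = matrix (h t)" for t
  have hM: "h t y = M t *v y" if "t \<in> T" for t y
    using h(1)[OF that] by (simp add: M_def matrix_works)
  have jac: "jacobian \<Phi> (at y) = M t" if "t \<in> T" "y \<in> interior t" for t y
    unfolding M_def using that h by (intro jacobian_affine_on[of "h t" t \<Phi> "d t"]) auto
  \<comment> \<open>The sign is read off at an interior point, where the Jacobian is known to be
    \<open>M t\<close>.\<close>
  have det: "det (M t) > 0" if t: "t \<in> T" for t
  proof -
    obtain y where y: "y \<in> interior t" using is_triangle_topology(3)[OF tri[OF t]] by blast
    then have "0 < det (jacobian \<Phi> (at y))"
      using iso t unfolding isomorphic_via_def by blast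
    then show ?thesis using jac[OF t y] by simp
  qed
  have "\<exists>g a. \<forall>y\<in>t. nodal_fun T' p y = y \<bullet> g + a" if "t \<in> T'" for t p
    using affine_map_on_realE[OF nodal_fun_properties(1)[OF T' that, of p]] by metis
  then obtain g a where g: "\<And>t p y. t \<in> T' \<Longrightarrow> y \<in> t \<Longrightarrow> nodal_fun T' p y = y \<bullet> g t p + a t p"
    by metis
  \<comment> \<open>By the chain rule this is the gradient on \<open>t\<close> of the target nodal
    function pulled back along \<open>\<Phi>\<close>.\<close>
  define G where "G t p = transpose (M t) *v g (\<Phi> ` t) (\<Phi> p)" for t p
  have G: "nodal_fun T p y = y \<bullet> G t p + (d t \<bullet> g (\<Phi> ` t) (\<Phi> p) + a (\<Phi> ` t) (\<Phi> p))"
    if "t \<in> T" "y \<in> t" "p \<in> vertices T" for t p y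
  proof -
    have "\<Phi> ` t \<in> T'" using bij that unfolding bij_betw_def by blast
    then have "nodal_fun T p y = (M t *v y + d t) \<bullet> g (\<Phi> ` t) (\<Phi> p) + a (\<Phi> ` t) (\<Phi> p)"
      using nodal_fun_isomorphic[OF T T' iso that(3), of y] g[of "\<Phi> ` t" "\<Phi> y" "\<Phi> p"]
        h(2)[OF that(1,2)] hM[OF that(1)] cl that(1,2) by (metis UnionI imageI)
    then show ?thesis
      by (simp add: G_def inner_add_left inner_matrix_vector_transpose)
  qed
  define A' where "A' t = (1 / \<bar>det (M t)\<bar>) *\<^sub>R (M t ** A t ** transpose (M t))" for t
  \<comment> \<open>The sum for \<open>T'\<close> needs data indexed by target triangles, whereas
    \<open>A'\<close> is indexed by source triangles; \<open>r\<close> translates.\<close>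
  define r where "r = inv_into T (\<lambda>t. \<Phi> ` t)"
  have r: "r (\<Phi> ` t) = t" if "t \<in> T" for t
    using bij that by (simp add: r_def bij_betw_inv_into_left)
  have pf: "\<exists>N. negligible N \<and> (\<forall>y \<in> t' - N. pushforward \<Omega> \<Phi> \<sigma> y = A' (r t'))" if t': "t' \<in> T'" for t'
  proof -
    obtain t where t: "t \<in> T" "t' = \<Phi> ` t" using bij t' unfolding bij_betw_def by blast
    \<comment> \<open>The exceptional set is cut down to \<open>t\<close>, where
      \<open>\<Phi>\<close> coincides with a globally differentiable affine map; such a map sends
      null sets to null sets.\<close>
    define Z where "Z = t \<inter> (N t \<union> frontier t)"
    have "negligible Z"
      unfolding Z_def using A(1)[OF t(1)] is_triangle_topology(2)[OF tri[OF t(1)]]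
      by (simp add: negligible_Int negligible_convex_frontier)
    moreover have "(\<lambda>y. h t y + d t) differentiable_on Z"
      by (intro differentiable_on_add differentiable_on_const linear_imp_differentiable_on h t)
    ultimately have "negligible ((\<lambda>y. h t y + d t) ` Z)"
      by (intro negligible_differentiable_image_negligible) auto
    moreover have "(\<lambda>y. h t y + d t) ` Z = \<Phi> ` Z"
      using h(2)[OF t(1)] by (intro image_cong) (auto simp: Z_def)
    ultimately have "negligible (\<Phi> ` Z)" by simp
    moreover have "pushforward \<Omega> \<Phi> \<sigma> y = A' (r t')" if y: "y \<in> t' - \<Phi> ` Z" for y
    proof -
      obtain z where z: "z \<in> t" "z \<notin> Z" "y = \<Phi> z" using y t(2) by blast
      have "inv_into (closure \<Omega>) \<Phi> y = z"
        using inj z t(1) cl by (auto intro: inv_into_f_f)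
      moreover have "z \<in> interior t" "\<sigma> z = A t"
        using z closure_subset A(2)[OF t(1)] by (auto simp: Z_def frontier_def)
      ultimately show ?thesis
        using jac[OF t(1)] r[OF t(1)] t(2) by (simp add: pushforward_def A'_def Let_def)
    qed
    ultimately show ?thesis by blast
  qed
  have meas: "measure lebesgue (\<Phi> ` t) = \<bar>det (M t)\<bar> * measure lebesgue t" if "t \<in> T" for t
  proof -
    have "\<Phi> ` t = (\<lambda>y. d t + y) ` (h t ` t)"
      unfolding image_image using h(2)[OF that] by (intro image_cong) auto
    then show ?thesis
      using measure_linear_image[OF h(1) is_triangle_topology(4)[OF tri]] that
      by (simp add: measure_translation M_def)
  qed
  have "stiffness \<Omega> T' (\<Phi> \<circ> x) (pushforward \<Omega> \<Phi> \<sigma>) j k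
      = (\<Sum>t'\<in>T'. (A' (r t') *v g t' (\<Phi> (x j))) \<bullet> g t' (\<Phi> (x k)) * measure lebesgue t')"
    using pf g by (intro stiffness_eq_sum[OF T' \<Omega>]) auto
  also have "\<dots> = (\<Sum>t\<in>T. (A' (r (\<Phi> ` t)) *v g (\<Phi> ` t) (\<Phi> (x j))) \<bullet> g (\<Phi> ` t) (\<Phi> (x k)) * measure lebesgue (\<Phi> ` t))"
    by (rule sum.reindex_bij_betw[OF bij, symmetric])
  also have "\<dots> = (\<Sum>t\<in>T. (A t *v G t (x j)) \<bullet> G t (x k) * measure lebesgue t)"
  proof (rule sum.cong[OF refl])
    \<comment> \<open>Transposition moves the outer factors of \<open>A'\<close> onto the target
      gradients, producing \<open>G\<close>; the factor \<open>1 / \<bar>det (M t)\<bar>\<close>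
      cancels against the area factor.\<close>
    fix t assume t: "t \<in> T"
    show "(A' (r (\<Phi> ` t)) *v g (\<Phi> ` t) (\<Phi> (x j))) \<bullet> g (\<Phi> ` t) (\<Phi> (x k)) * measure lebesgue (\<Phi> ` t)
      = (A t *v G t (x j)) \<bullet> G t (x k) * measure lebesgue t"
      using det[OF t] unfolding r[OF t] meas[OF t]
      by (simp only: A'_def G_def scaleR_matrix_vector_assoc[symmetric] matrix_vector_mul_assoc[symmetric]
          inner_scaleR_left inner_matrix_vector_transpose) simp
  qed
  also have "\<dots> = stiffness \<Omega> T x \<sigma> j k"
    using A G jk by (intro stiffness_eq_sum[OF T \<Omega>, symmetric]) blast+
  finally show ?thesis .
qed

section \<open>Equality of the discrete boundary maps from equality of the linear systems\<close>

theorem theorem1p3: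
  fixes \<Omega> :: "(real^2) set" and T T' :: "(real^2) set set"
    and \<Phi> :: "real^2 \<Rightarrow> real^2" and \<sigma> :: "real^2 \<Rightarrow> real^2^2"
    and N B :: nat and x :: "nat \<Rightarrow> real^2"
  assumes "simple_polygon_interior \<Omega>"
    and "plane_triangulation \<Omega> T" and "plane_triangulation \<Omega> T'"
    and "vertex_labelling \<Omega> T N B x"
    and "isomorphic_via \<Omega> T T' \<Phi>"
    and "\<forall>y \<in> frontier \<Omega>. \<Phi> y = y"
    and "\<sigma> \<in> PC_plus \<Omega> T"
  shows "FEM_map \<Omega> T N B x \<sigma> = FEM_map \<Omega> T' N B (\<Phi> \<circ> x) (pushforward \<Omega> \<Phi> \<sigma>)"
proof -
  have x: "x j \<in> vertices T" if "j \<in> {1..N}" for j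
    using assms(4) that unfolding vertex_labelling_def bij_betw_def by blast
  have stiff: "stiffness \<Omega> T' (\<Phi> \<circ> x) (pushforward \<Omega> \<Phi> \<sigma>) j k = stiffness \<Omega> T x \<sigma> j k"
    if "j \<in> {1..N}" "k \<in> {1..N}" for j k
    using stiffness_pushforward[OF simple_polygon_interior_topology[OF assms(1)] assms(2,3,5,7)] x that
    by blast
  \<comment> \<open>Equal coefficients and equal right-hand sides make the predicates under the two
    \<open>THE\<close> operators equivalent, so the described vectors coincide.\<close>
  have "FEM_solution \<Omega> T' N B (\<Phi> \<circ> x) (pushforward \<Omega> \<Phi> \<sigma>) f = FEM_solution \<Omega> T N B x \<sigma> f" for f
  proof -
    have "FEM_matrix \<Omega> T' B (\<Phi> \<circ> x) (pushforward \<Omega> \<Phi> \<sigma>) j k = FEM_matrix \<Omega> T B x \<sigma> j k"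
      if "j \<in> {1..N}" "k \<in> {1..N}" for j k
      using stiff[OF that] by (simp add: FEM_matrix_def)
    then have "(\<Sum>k=1..N. FEM_matrix \<Omega> T' B (\<Phi> \<circ> x) (pushforward \<Omega> \<Phi> \<sigma>) j k * u k)
        = (\<Sum>k=1..N. FEM_matrix \<Omega> T B x \<sigma> j k * u k)" if "j \<in> {1..N}" for j and u :: "nat \<Rightarrow> real"
      using that by (intro sum.cong) simp_all
    then show ?thesis
      unfolding FEM_solution_def
      by (intro arg_cong[where f = The] ext conj_cong ball_cong refl) (simp only:)
  qed
  \<comment> \<open>Boundary rows thus fall under \<open>stiff\<close>; for indices outside
    \<open>{1..B}\<close> both maps are 0 by definition.\<close>
  moreover have "{1..B} \<subseteq> {1..N}"
    using assms(4) unfolding vertex_labelling_def by auto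
  ultimately show ?thesis
    unfolding FEM_map_def using stiff by (intro ext) (auto intro!: sum.cong simp: subset_eq)
qed

end
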